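(* Let $\Sigma$ be a signed graph and $A$ a negation set of $\Sigma$. Then $A$ is bipartite (i.e., the graph formed by the edges of $A$ and their endpoints is bipartite) if and only if there exists a negation set $B$ of $\Sigma$ with $A\cap B=\emptyset$.
   Context: Throughout, graphs are finite, simple and connected. A signed graph is a pair $\Sigma=(\Gamma,\sigma)$ with $\sigma: E(\Gamma)\to\{+,-\}$. The sign of a circle (cycle) is the product of the signs of its edges; $\Sigma$ is balanced if every circle is positive. A negation set is a set of edges whose negation (changing the sign of each of its edges) yields a balanced signed graph. *)

theory Defs
  imports Main
begin

locale connected_simple_graph =
  fixes V :: "'v set" and E :: "'v set set"
  assumes finite_vertices: "finite V"
    and nonempty: "V \<noteq> {}"
    and edge: "e \<in> E \<Longrightarrow> e \<subseteq> V \<and> card e = 2"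
    and connected: "\<lbrakk>u \<in> V; v \<in> V\<rbrakk> \<Longrightarrow> (u, v) \<in> {(x, y). {x, y} \<in> E}\<^sup>*"

text \<open>The signs are the integers 1 and -1, so that products of signs and negation are those of
  the integers. Values of the sign function outside the edge set are irrelevant.\<close>

locale signed_graph = connected_simple_graph V E
  for V :: "'v set" and E :: "'v set set" +
  fixes \<sigma> :: "'v set \<Rightarrow> int"
  assumes sign: "e \<in> E \<Longrightarrow> \<sigma> e \<in> {1, -1}"

text \<open>A circle is given by a cyclic listing of its vertices; \<^term>\<open>rotate1 vs\<close> pairs every vertex
  with its successor, the last one with the first.\<close>

definition circle_edges :: "'v list \<Rightarrow> 'v set set" where
  "circle_edges vs = set (map2 (\<lambda>u v. {u, v}) vs (rotate1 vs))"

definition is_circle :: "'v set set \<Rightarrow> 'v list \<Rightarrow> bool" where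
  "is_circle E vs \<longleftrightarrow> 3 \<le> length vs \<and> distinct vs \<and> circle_edges vs \<subseteq> E"

definition circle_sign :: "('v set \<Rightarrow> int) \<Rightarrow> 'v list \<Rightarrow> int" where
  "circle_sign \<sigma> vs = (\<Prod>e\<in>circle_edges vs. \<sigma> e)"

definition balanced :: "'v set set \<Rightarrow> ('v set \<Rightarrow> int) \<Rightarrow> bool" where
  "balanced E \<sigma> \<longleftrightarrow> (\<forall>vs. is_circle E vs \<longrightarrow> circle_sign \<sigma> vs = 1)"

definition negate :: "'v set set \<Rightarrow> ('v set \<Rightarrow> int) \<Rightarrow> 'v set \<Rightarrow> int" where
  "negate A \<sigma> e = (if e \<in> A then - \<sigma> e else \<sigma> e)"

definition negation_set :: "'v set set \<Rightarrow> ('v set \<Rightarrow> int) \<Rightarrow> 'v set set \<Rightarrow> bool" where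
  "negation_set E \<sigma> A \<longleftrightarrow> A \<subseteq> E \<and> balanced E (negate A \<sigma>)"

definition bipartite :: "'v set \<Rightarrow> 'v set set \<Rightarrow> bool" where
  "bipartite V E \<longleftrightarrow> (\<exists>X Y. X \<union> Y = V \<and> X \<inter> Y = {} \<and> (\<forall>e\<in>E. \<exists>x\<in>X. \<exists>y\<in>Y. e = {x, y}))"

end

theory Submission
  imports Defs
begin

text \<open>By Harary's theorem a signed graph is balanced iff its signs have the form
  \<open>\<theta> u * \<theta> v\<close> for some \<open>\<theta>\<close> with values 1 and -1; so the negation sets are the sets of edges
  at which the given signs differ from such a product. If \<open>A\<close> and \<open>B\<close> are the negation sets of
  \<open>\<alpha>\<close> and \<open>\<beta>\<close>, then an edge of \<open>A\<close> lies outside \<open>B\<close> iff \<open>\<alpha> * \<beta>\<close> takes different values at its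
  two ends. Hence \<open>B\<close> is disjoint from \<open>A\<close> iff the sign of \<open>\<alpha> * \<beta>\<close> is a bipartition of \<open>A\<close>.\<close>

section \<open>Walks, circles and their signs\<close>

fun walk_edges :: "'v list \<Rightarrow> 'v set list" where
  "walk_edges (u # v # vs) = {u, v} # walk_edges (v # vs)"
| "walk_edges _ = []"

text \<open>The product runs over a list, so an edge traversed twice counts twice;
  \<open>circle_sign\<close> takes its product over a set of edges.\<close>

definition walk_sign :: "('v set \<Rightarrow> int) \<Rightarrow> 'v list \<Rightarrow> int" where
  "walk_sign \<sigma> vs = prod_list (map \<sigma> (walk_edges vs))"

lemma walk_sign_simps [simp]:
  "walk_sign \<sigma> [] = 1" "walk_sign \<sigma> [v] = 1"
  "walk_sign \<sigma> (u # v # vs) = \<sigma> {u, v} * walk_sign \<sigma> (v # vs)"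
  by (simp_all add: walk_sign_def)

lemma walk_edges_append:
  "xs \<noteq> [] \<Longrightarrow> ys \<noteq> [] \<Longrightarrow>
    walk_edges (xs @ ys) = walk_edges xs @ {last xs, hd ys} # walk_edges ys"
proof (induction xs rule: walk_edges.induct)
  case ("2_2" v)
  then show ?case by (cases ys) auto
qed auto

text \<open>Cuts a walk at a vertex that both pieces keep; this is the tool for excising a closed
  subwalk.\<close>

lemma walk_edges_append_overlap:
  "walk_edges (xs @ y # ys) = walk_edges (xs @ [y]) @ walk_edges (y # ys)"
  by (cases "xs = []"; cases ys) (simp_all add: walk_edges_append)

lemma walk_edges_rev: "walk_edges (rev vs) = rev (walk_edges vs)"
proof (induction vs rule: walk_edges.induct)
  case (1 u v vs)
  then show ?case
    using walk_edges_append[of "rev (v # vs)" "[u]"] by (simp add: insert_commute)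
qed auto

lemma walk_edges_subset: "e \<in> set (walk_edges vs) \<Longrightarrow> e \<subseteq> set vs"
  by (induction vs rule: walk_edges.induct) auto

lemma distinct_walk_edges: "distinct vs \<Longrightarrow> distinct (walk_edges vs)"
proof (induction vs rule: walk_edges.induct)
  case (1 u v vs)
  then show ?case using walk_edges_subset[of "{u, v}" "v # vs"] by auto
qed auto

text \<open>Without its first edge the closed walk has distinct vertices, hence distinct edges. The
  first edge does not recur because the only later edge at the second vertex leads to the third,
  which differs from the first; with two vertices the same edge would be used twice.\<close>

lemma distinct_walk_edges_circle:
  assumes "3 \<le> length vs" "distinct vs"
  shows "distinct (walk_edges (vs @ [hd vs]))"
proof -
  obtain x y z zs where vs: "vs = x # y # z # zs"
    using assms(1) by (auto simp: numeral_3_eq_3 Suc_le_length_iff)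
  have "distinct (walk_edges (y # z # zs @ [x]))"
    using assms(2) by (intro distinct_walk_edges) (auto simp: vs)
  moreover have "{x, y} \<notin> set (walk_edges (y # z # zs @ [x]))"
    using assms(2) walk_edges_subset[of "{x, y}" "z # zs @ [x]"]
    by (auto simp: vs doubleton_eq_iff)
  ultimately show ?thesis by (simp add: vs)
qed

lemma circle_edges_eq_walk_edges:
  assumes "vs \<noteq> []"
  shows "circle_edges vs = set (walk_edges (vs @ [hd vs]))"
proof -
  have "map2 (\<lambda>u v. {u, v}) (x # xs) (xs @ [z]) = walk_edges (x # xs @ [z])" for x xs and z :: 'a
    by (induction xs arbitrary: x) auto
  with assms show ?thesis
    by (cases vs) (simp_all add: circle_edges_def del: zip_Cons_Cons)
qed

lemma circle_sign_eq_walk_sign: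
  assumes "3 \<le> length vs" "distinct vs"
  shows "circle_sign \<sigma> vs = walk_sign \<sigma> (vs @ [hd vs])"
proof -
  have "vs \<noteq> []" using assms(1) by auto
  then show ?thesis
    using distinct_walk_edges_circle[OF assms]
    by (simp add: circle_sign_def walk_sign_def circle_edges_eq_walk_edges
        prod.distinct_set_conv_list)
qed

text \<open>The product telescopes: each intermediate position contributes its \<theta> value twice,
  and these values square to 1.\<close>

lemma walk_sign_product:
  assumes "\<And>v. \<theta> v \<in> {1, -1}" "\<And>u v. {u, v} \<in> E \<Longrightarrow> \<sigma> {u, v} = \<theta> u * \<theta> v"
    and "vs \<noteq> []" "set (walk_edges vs) \<subseteq> E"
  shows "walk_sign \<sigma> vs = \<theta> (hd vs) * \<theta> (last vs)"
proof -
  have "\<theta> v * \<theta> v = 1" for v using assms(1)[of v] by auto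
  then have "\<theta> v * (\<theta> v * c) = c" for v c by (simp flip: mult.assoc)
  with \<open>\<And>v. \<theta> v * \<theta> v = 1\<close> assms(2-) show ?thesis
    by (induction vs rule: walk_edges.induct) (simp_all add: mult.assoc)
qed

lemma (in connected_simple_graph) walk_exists:
  assumes "u \<in> V" "v \<in> V"
  shows "\<exists>ws. ws \<noteq> [] \<and> hd ws = u \<and> last ws = v \<and> set (walk_edges ws) \<subseteq> E"
  using connected[OF assms]
proof (induction rule: rtrancl_induct)
  case base
  show ?case by (rule exI[of _ "[u]"]) simp
next
  case (step y z)
  then obtain ws where "ws \<noteq> []" "hd ws = u" "last ws = y" "set (walk_edges ws) \<subseteq> E"
    by blast
  with step(2) show ?case
    by (intro exI[of _ "ws @ [z]"]) (simp add: walk_edges_append)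
qed

section \<open>Harary's theorem\<close>

context signed_graph
begin

lemma sign_square: "e \<in> E \<Longrightarrow> \<sigma> e * \<sigma> e = 1"
  using sign by fastforce

lemma walk_sign_values:
  "set (walk_edges vs) \<subseteq> E \<Longrightarrow> walk_sign \<sigma> vs \<in> {1, -1}"
proof (induction vs rule: walk_edges.induct)
  case (1 u v vs)
  then show ?case using sign[of "{u, v}"] by auto
qed simp_all

text \<open>Induction on length: a repeated vertex splits the walk into two shorter closed walks
  whose signs multiply to the given one. Without repetition only a circle or a degenerate walk
  remains.\<close>

lemma closed_walk_positive:
  assumes "balanced E \<sigma>"
    and "ws \<noteq> []" "hd ws = last ws" "set (walk_edges ws) \<subseteq> E"
  shows "walk_sign \<sigma> ws = 1"
  using assms(2-)
proof (induction ws rule: length_induct)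
  case (1 ws)
  from 1(2) obtain vs x where ws: "ws = vs @ [x]" by (cases ws rule: rev_cases) auto
  then have hd: "hd (vs @ [x]) = x" and E: "set (walk_edges (vs @ [x])) \<subseteq> E"
    using 1(3,4) by simp_all
  show ?case
  proof (cases "distinct vs")
    case True
    \<comment> \<open>The short cases are not circles: a single vertex has the empty product, a loop
      is no edge, and an edge traversed back and forth contributes the square of its sign.\<close>
    consider "vs = []" | y where "vs = [y]" | y z where "vs = [y, z]" | "3 \<le> length vs"
      by (cases vs; cases "tl vs"; cases "tl (tl vs)") auto
    then show ?thesis
    proof cases
      case 1
      then show ?thesis by (simp add: ws)
    next
      case (2 y)
      then have "{x} \<in> E" using hd E by simp
      then show ?thesis using edge by fastforce
    next
      case (3 y z)
      then show ?thesis using hd E sign_square[of "{x, z}"] by (simp add: ws insert_commute)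
    next
      case 4
      then have "vs \<noteq> []" by auto
      then have "hd vs = x" using hd by simp
      then have "is_circle E vs"
        using 4 True E \<open>vs \<noteq> []\<close> by (simp add: is_circle_def circle_edges_eq_walk_edges)
      then show ?thesis
        using assms(1) circle_sign_eq_walk_sign[OF 4 True, of \<sigma>] \<open>hd vs = x\<close>
        by (simp add: balanced_def ws)
    qed
  next
    case False
    then obtain as bs cs y where vs: "vs = as @ [y] @ bs @ [y] @ cs"
      using not_distinct_decomp by blast
    then have split: "ws = as @ y # bs @ y # cs @ [x]"
      using ws by simp
    \<comment> \<open>\<open>?inner\<close> is the closed walk between the two occurrences of
      \<open>y\<close>; \<open>?outer\<close> is what is left of \<open>ws\<close> when that detour
      is skipped.\<close>
    let ?inner = "y # bs @ [y]" and ?outer = "as @ y # cs @ [x]"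
    have edges: "walk_edges ws =
        walk_edges (as @ [y]) @ walk_edges ?inner @ walk_edges (y # cs @ [x])"
      using walk_edges_append_overlap[of as y "bs @ y # cs @ [x]"]
        walk_edges_append_overlap[of "y # bs" y "cs @ [x]"] split by simp
    have outer: "walk_edges ?outer = walk_edges (as @ [y]) @ walk_edges (y # cs @ [x])"
      by (rule walk_edges_append_overlap)
    have shorter: "length ?inner < length ws" "length ?outer < length ws"
      by (simp_all add: split)
    have "hd ?outer = x" using hd by (simp add: vs hd_append split: if_splits)
    then have "walk_sign \<sigma> ?outer = 1"
      using 1(1)[rule_format, OF shorter(2)] 1(4) edges outer by simp
    moreover have "walk_sign \<sigma> ?inner = 1"
      using 1(1)[rule_format, OF shorter(1)] 1(4) edges by simp
    moreover have "walk_sign \<sigma> ws = walk_sign \<sigma> ?inner * walk_sign \<sigma> ?outer"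
      unfolding walk_sign_def edges outer by (simp add: mult_ac)
    ultimately show ?thesis by simp
  qed
qed

text \<open>Given balance, \<theta> at a vertex is the sign of a chosen walk to it from a fixed
  root. Conversely, the product telescopes around a circle to the square of \<theta> at its starting
  vertex.\<close>

theorem harary_balance:
  "balanced E \<sigma> \<longleftrightarrow>
    (\<exists>\<theta>. (\<forall>v. \<theta> v \<in> {1, -1}) \<and> (\<forall>u v. {u, v} \<in> E \<longrightarrow> \<sigma> {u, v} = \<theta> u * \<theta> v))"
  (is "_ \<longleftrightarrow> (\<exists>\<theta>. ?P \<theta>)")
proof
  assume bal: "balanced E \<sigma>"
  obtain r where r: "r \<in> V" using nonempty by auto
  define W where "W v ws \<longleftrightarrow> ws \<noteq> [] \<and> hd ws = r \<and> last ws = v \<and> set (walk_edges ws) \<subseteq> E"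
    for v ws
  define w where "w v = (SOME ws. W v ws)" for v
  have w: "W v (w v)" if "v \<in> V" for v
    unfolding w_def by (rule someI_ex) (use walk_exists[OF r that] in \<open>simp add: W_def\<close>)
  \<comment> \<open>The value 1 outside \<open>V\<close> only keeps \<theta> within 1 and -1 on the
    whole type.\<close>
  define \<theta> where "\<theta> v = (if v \<in> V then walk_sign \<sigma> (w v) else 1)" for v
  have "\<theta> v \<in> {1, -1}" for v
    using w[of v] walk_sign_values[of "w v"] by (simp add: \<theta>_def W_def)
  moreover have "\<sigma> {u, v} = \<theta> u * \<theta> v" if e: "{u, v} \<in> E" for u v
  proof -
    have uv: "u \<in> V" "v \<in> V" using edge[OF e] by auto
    note W = w[OF uv(1), unfolded W_def] w[OF uv(2), unfolded W_def]
    \<comment> \<open>Going from the root to \<open>u\<close>, across the edge and back from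
      \<open>v\<close> is a closed walk, so positivity determines the sign of the edge.\<close>
    have edges: "walk_edges (w u @ rev (w v)) =
        walk_edges (w u) @ {u, v} # rev (walk_edges (w v))"
      using W by (simp add: walk_edges_append walk_edges_rev hd_rev)
    have "walk_sign \<sigma> (w u @ rev (w v)) = 1"
      using W e by (intro closed_walk_positive[OF bal]) (auto simp: edges last_rev)
    moreover have "walk_sign \<sigma> (w u @ rev (w v)) = walk_sign \<sigma> (w u) * \<sigma> {u, v} * walk_sign \<sigma> (w v)"
      by (simp add: walk_sign_def edges rev_map[symmetric] prod_list.rev)
    ultimately show ?thesis
      using uv W sign[OF e] walk_sign_values[of "w u"] walk_sign_values[of "w v"]
      by (auto simp: \<theta>_def)
  qed
  ultimately show "\<exists>\<theta>. ?P \<theta>" by blast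
next
  assume "\<exists>\<theta>. ?P \<theta>"
  then obtain \<theta> where \<theta>: "?P \<theta>" ..
  show "balanced E \<sigma>"
    unfolding balanced_def
  proof (intro allI impI)
    fix vs assume c: "is_circle E vs"
    then have "vs \<noteq> []" by (auto simp: is_circle_def)
    then have "walk_sign \<sigma> (vs @ [hd vs]) = \<theta> (hd vs) * \<theta> (hd vs)"
      using \<theta> c walk_sign_product[of \<theta> E \<sigma> "vs @ [hd vs]"]
      by (simp add: is_circle_def circle_edges_eq_walk_edges)
    moreover have "\<theta> (hd vs) \<in> {1, -1}" using \<theta> by blast
    ultimately show "circle_sign \<sigma> vs = 1"
      using c by (auto simp: is_circle_def circle_sign_eq_walk_sign)
  qed
qed

text \<open>Harary's theorem applied to \<open>negate A \<sigma>\<close>: all values being 1 or -1,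
  an edge must be negated exactly where \<sigma> differs from the product.\<close>

lemma negation_set_iff:
  "negation_set E \<sigma> A \<longleftrightarrow> A \<subseteq> E \<and>
    (\<exists>\<theta>. (\<forall>v. \<theta> v \<in> {1, -1}) \<and> (\<forall>u v. {u, v} \<in> E \<longrightarrow> {u, v} \<in> A \<longleftrightarrow> \<sigma> {u, v} \<noteq> \<theta> u * \<theta> v))"
proof -
  interpret neg: signed_graph V E "negate A \<sigma>"
    by unfold_locales (use sign in \<open>auto simp: negate_def\<close>)
  have "negate A \<sigma> {u, v} = \<theta> u * \<theta> v \<longleftrightarrow> ({u, v} \<in> A \<longleftrightarrow> \<sigma> {u, v} \<noteq> \<theta> u * \<theta> v)"
    if "\<forall>v. \<theta> v \<in> {1, -1}" "{u, v} \<in> E" for \<theta> u v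
  proof -
    have "\<theta> u \<in> {1, -1}" "\<theta> v \<in> {1, -1}" using that(1) by blast+
    with sign[OF that(2)] show ?thesis by (auto simp: negate_def)
  qed
  then show ?thesis
    unfolding negation_set_def neg.harary_balance by (metis (lifting))
qed

end

section \<open>Bipartite and disjoint negation sets\<close>

theorem theorem3p1:
  fixes V :: "'v set" and E :: "'v set set" and \<sigma> :: "'v set \<Rightarrow> int" and A :: "'v set set"
  assumes "signed_graph V E \<sigma>"
    and "negation_set E \<sigma> A"
  shows "bipartite (\<Union>A) A \<longleftrightarrow> (\<exists>B. negation_set E \<sigma> B \<and> A \<inter> B = {})"
proof -
  interpret signed_graph V E \<sigma> by fact
  obtain \<alpha> where A: "A \<subseteq> E" and \<alpha>: "\<And>v. \<alpha> v = 1 \<or> \<alpha> v = -1"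
    and A_iff: "\<And>u v. {u, v} \<in> E \<Longrightarrow> {u, v} \<in> A \<longleftrightarrow> \<sigma> {u, v} \<noteq> \<alpha> u * \<alpha> v"
    using assms(2) unfolding negation_set_iff by auto
  have pair: "\<exists>u v. e = {u, v}" if "e \<in> E" for e
    using edge[OF that] by (auto simp: card_2_iff)
  show ?thesis
  proof
    assume "bipartite (\<Union>A) A"
    then obtain X Y where "X \<inter> Y = {}" and XY: "\<forall>e\<in>A. \<exists>x\<in>X. \<exists>y\<in>Y. e = {x, y}"
      unfolding bipartite_def by blast
    \<comment> \<open>Changing \<alpha> off \<open>X\<close> reverses the product at the ends of
      every edge between \<open>X\<close> and \<open>Y\<close>, so \<beta> agrees with \<sigma> on
      all of \<open>A\<close>.\<close>
    define \<beta> where "\<beta> v = (if v \<in> X then \<alpha> v else - \<alpha> v)" for v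
    define B where "B = {{u, v} |u v. {u, v} \<in> E \<and> \<sigma> {u, v} \<noteq> \<beta> u * \<beta> v}"
    have B_iff: "{u, v} \<in> B \<longleftrightarrow> \<sigma> {u, v} \<noteq> \<beta> u * \<beta> v" if "{u, v} \<in> E" for u v
      using that by (auto simp: B_def doubleton_eq_iff mult.commute insert_commute)
    have "\<forall>v. \<beta> v \<in> {1, -1}" using \<alpha> by (auto simp: \<beta>_def)
    then have "negation_set E \<sigma> B"
      unfolding negation_set_iff using B_iff by (auto simp: B_def)
    moreover have "e \<notin> B" if "e \<in> A" for e
    proof -
      from XY that obtain x y where e: "e = {x, y}" "x \<in> X" "y \<in> Y" by blast
      then have "\<beta> x * \<beta> y = - (\<alpha> x * \<alpha> y)"
        using \<open>X \<inter> Y = {}\<close> by (auto simp: \<beta>_def)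
      moreover have "{x, y} \<in> E" using that e A by blast
      ultimately show ?thesis
        using A_iff B_iff that e sign[of e] \<alpha>[of x] \<alpha>[of y] by auto
    qed
    ultimately show "\<exists>B. negation_set E \<sigma> B \<and> A \<inter> B = {}" by blast
  next
    assume "\<exists>B. negation_set E \<sigma> B \<and> A \<inter> B = {}"
    then obtain B \<beta> where disj: "A \<inter> B = {}" and \<beta>: "\<And>v. \<beta> v = 1 \<or> \<beta> v = -1"
      and B_iff: "\<And>u v. {u, v} \<in> E \<Longrightarrow> {u, v} \<in> B \<longleftrightarrow> \<sigma> {u, v} \<noteq> \<beta> u * \<beta> v"
      unfolding negation_set_iff by auto
    \<comment> \<open>The side of the bipartition on which \<alpha> * \<beta> is 1.\<close>
    define X where "X = {v \<in> \<Union>A. \<alpha> v = \<beta> v}"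
    have "\<exists>x\<in>X. \<exists>y\<in>\<Union>A - X. e = {x, y}" if "e \<in> A" for e
    proof -
      obtain u v where e: "e = {u, v}" using pair[of e] \<open>e \<in> A\<close> A by blast
      \<comment> \<open>On such an edge \<sigma> differs from the \<alpha> product but equals the
        \<beta> product, so \<alpha> and \<beta> agree at exactly one end.\<close>
      have "{u, v} \<in> E" "{u, v} \<notin> B" using that A disj e by auto
      then have "\<alpha> u * \<alpha> v \<noteq> \<beta> u * \<beta> v"
        using A_iff[of u v] B_iff[of u v] that e by auto
      then have "\<alpha> u = \<beta> u \<longleftrightarrow> \<alpha> v \<noteq> \<beta> v"
        using \<alpha>[of u] \<alpha>[of v] \<beta>[of u] \<beta>[of v] by auto
      moreover have "u \<in> \<Union>A" "v \<in> \<Union>A" using that e by auto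
      ultimately have "u \<in> X \<and> v \<in> \<Union>A - X \<or> v \<in> X \<and> u \<in> \<Union>A - X"
        by (auto simp: X_def)
      then show ?thesis using e by (metis insert_commute)
    qed
    then show "bipartite (\<Union>A) A"
      unfolding bipartite_def by (intro exI[of _ X] exI[of _ "\<Union>A - X"]) (auto simp: X_def)
  qed
qed

end
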